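(* Let $D=(V,A)$ be a finite digraph and let $G$ be a finite Abelian group of order $k$. Then the number of NL-$G$-coflows of $D$ depends only on $k$ (and not on the structure of $G$), and it equals $\psi_{NL}^D(k)$.
   Context: Digraphs may have loops, parallel and antiparallel arcs. A map $g:A\to G$ is a $G$-coflow if for every (weak, i.e. not necessarily directed) cycle $C\subseteq A$ with a chosen traversal direction, $\sum_{a\in C^+}g(a)=\sum_{a\in C^-}g(a)$, where $C^+$, $C^-$ are the arcs of $C$ traversed forward resp. backward. A feedback arc set is a set $S\subseteq A$ such that $D-S$ has no directed cycle. An NL-$G$-coflow is a $G$-coflow whose support $\{a: g(a)\neq 0\}$ contains a feedback arc set. Definition of $\psi_{NL}^D$: let $\mathcal U$ be the set of all arc sets $C\subseteq A$ that are unions of arc sets of finitely many directed cycles of $D$ (including the empty union $C=\emptyset$). For $C\in\mathcal U$ let $A/C$ denote the digraph obtained from $D$ by contracting the arcs of $C$; let $\mathcal C=\{A/C: C\in\mathcal U\}$ be partially ordered by $A/C'\le A/C$ iff $C\subseteq C'$ (so $A=A/\emptyset$ is the maximum). Let $\mu(A,Y)$ denote the Möbius function value on the interval between $Y$ and $A$ in this poset (Möbius inversion from above), equivalently $\mu(A,A/C)=\mu_{\mathcal U}(\emptyset,C)$ for the Möbius function $\mu_{\mathcal U}$ of $\mathcal U$ ordered by inclusion. For a digraph $Y$, $rk(Y)$ is the rank of its incidence matrix, i.e. its number of vertices minus its number of (weakly) connected components. Then $\psi_{NL}^D(x)=\sum_{Y\in\mathcal C}\mu(A,Y)x^{rk(Y)}$.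 *)

theory Defs
  imports
    "Graph_Theory.Arc_Walk"
    "Graph_Theory.Digraph_Component"
    "HOL-Algebra.FiniteProduct"
    "HOL-Algebra.Coset"
    "HOL-Computational_Algebra.Polynomial"
begin

text \<open>
  Traversing \<open>(a, True)\<close> means traversing the arc \<open>a\<close> forward, traversing \<open>(a, False)\<close>
  means traversing it backward.
\<close>

definition traversals :: "('a, 'b) pre_digraph \<Rightarrow> ('a, 'b \<times> bool) pre_digraph" where
  "traversals D =
     \<lparr> verts = verts D,
       arcs = arcs D \<times> UNIV,
       tail = (\<lambda>(a, fwd). if fwd then tail D a else head D a),
       head = (\<lambda>(a, fwd). if fwd then head D a else tail D a) \<rparr>"

text \<open>
  The distinctness condition excludes running through a single arc forth and back, which would
  otherwise be a closed walk of length two. Loops, and pairs of parallel or antiparallel arcs, do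
  form weak cycles.
\<close>

definition weak_cycle :: "('a, 'b) pre_digraph \<Rightarrow> ('b \<times> bool) list \<Rightarrow> bool" where
  "weak_cycle D p \<longleftrightarrow> pre_digraph.cycle (traversals D) p \<and> distinct (map fst p)"

definition forward_arcs :: "('b \<times> bool) list \<Rightarrow> 'b set" where
  "forward_arcs p = {a. (a, True) \<in> set p}"

definition backward_arcs :: "('b \<times> bool) list \<Rightarrow> 'b set" where
  "backward_arcs p = {a. (a, False) \<in> set p}"

text \<open>
  Abelian groups are written multiplicatively, as in \<^theory>\<open>HOL-Algebra.Group\<close>. Maps on the arc
  set are extensional, so that they can be counted.
\<close>

definition coflow ::
    "('a, 'b) pre_digraph \<Rightarrow> ('g, 'm) monoid_scheme \<Rightarrow> ('b \<Rightarrow> 'g) \<Rightarrow> bool" where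
  "coflow D G g \<longleftrightarrow> g \<in> arcs D \<rightarrow>\<^sub>E carrier G \<and>
     (\<forall>p. weak_cycle D p \<longrightarrow> finprod G g (forward_arcs p) = finprod G g (backward_arcs p))"

definition feedback_arc_set :: "('a, 'b) pre_digraph \<Rightarrow> 'b set \<Rightarrow> bool" where
  "feedback_arc_set D S \<longleftrightarrow>
     S \<subseteq> arcs D \<and> (\<nexists>p. pre_digraph.cycle (D\<lparr>arcs := arcs D - S\<rparr>) p)"

definition coflow_support ::
    "('a, 'b) pre_digraph \<Rightarrow> ('g, 'm) monoid_scheme \<Rightarrow> ('b \<Rightarrow> 'g) \<Rightarrow> 'b set" where
  "coflow_support D G g = {a \<in> arcs D. g a \<noteq> \<one>\<^bsub>G\<^esub>}"

definition NL_coflow ::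
    "('a, 'b) pre_digraph \<Rightarrow> ('g, 'm) monoid_scheme \<Rightarrow> ('b \<Rightarrow> 'g) \<Rightarrow> bool" where
  "NL_coflow D G g \<longleftrightarrow> coflow D G g \<and> (\<exists>S \<subseteq> coflow_support D G g. feedback_arc_set D S)"

definition weak_component :: "('a, 'b) pre_digraph \<Rightarrow> 'a \<Rightarrow> 'a set" where
  "weak_component D v = {w. v \<rightarrow>\<^sup>*\<^bsub>with_proj (mk_symmetric D)\<^esub> w}"

definition weak_components :: "('a, 'b) pre_digraph \<Rightarrow> 'a set set" where
  "weak_components D = weak_component D ` verts D"

text \<open>The rank of the incidence matrix.\<close>

definition digraph_rank :: "('a, 'b) pre_digraph \<Rightarrow> nat" where
  "digraph_rank D = card (verts D) - card (weak_components D)"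

text \<open>
  The vertices of the contraction are the classes of vertices identified by contracting \<open>C\<close>. Arcs
  outside \<open>C\<close> are kept, even those that become loops.
\<close>

definition contract_arcs :: "('a, 'b) pre_digraph \<Rightarrow> 'b set \<Rightarrow> ('a set, 'b) pre_digraph" where
  "contract_arcs D C =
     \<lparr> verts = weak_components (D\<lparr>arcs := C\<rparr>),
       arcs = arcs D - C,
       tail = (\<lambda>a. weak_component (D\<lparr>arcs := C\<rparr>) (tail D a)),
       head = (\<lambda>a. weak_component (D\<lparr>arcs := C\<rparr>) (head D a)) \<rparr>"

definition dicycle_unions :: "('a, 'b) pre_digraph \<Rightarrow> 'b set set" where
  "dicycle_unions D = {\<Union>(set ` P) | P. finite P \<and> (\<forall>p \<in> P. pre_digraph.cycle D p)}"

definition dicycle_contractions :: "('a, 'b) pre_digraph \<Rightarrow> ('a set, 'b) pre_digraph set" where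
  "dicycle_contractions D = contract_arcs D ` dicycle_unions D"

definition contraction_order ::
    "('a, 'b) pre_digraph \<Rightarrow> (('a set, 'b) pre_digraph \<times> ('a set, 'b) pre_digraph) set" where
  "contraction_order D =
     {(contract_arcs D C', contract_arcs D C) | C C'.
        C \<in> dicycle_unions D \<and> C' \<in> dicycle_unions D \<and> C \<subseteq> C'}"

text \<open>
  The Moebius function of the finite poset \<open>(P, r)\<close>, where \<open>(x, y) \<in> r\<close> means \<open>x \<le> y\<close>. The
  tests that \<open>P\<close> is finite and \<open>r\<close> a partial order are there for termination only.
\<close>

function moebius :: "'c set \<Rightarrow> ('c \<times> 'c) set \<Rightarrow> 'c \<Rightarrow> 'c \<Rightarrow> int" where
  "moebius P r x y =
     (if finite P \<and> partial_order_on P r \<and> (x, y) \<in> r then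
        if x = y then 1
        else - (\<Sum>z \<in> {z \<in> P. (x, z) \<in> r \<and> (z, y) \<in> r \<and> z \<noteq> y}. moebius P r x z)
      else 0)"
  by pat_completeness auto
termination
proof (relation "measure (\<lambda>(P, r, x, y). card {w \<in> P. (w, y) \<in> r})", goal_cases)
  case 1
  show ?case by simp
next
  case (2 P r x y z)
  have fin: "finite P" and po: "partial_order_on P r"
    and z: "z \<in> P" "(z, y) \<in> r" "z \<noteq> y"
    using 2 by auto
  have tr: "trans r" and an: "antisym r" and "refl_on P r" "r \<subseteq> P \<times> P"
    using po by (auto simp: partial_order_on_def preorder_on_def)
  then have "y \<in> P" "(y, y) \<in> r"
    using z by (auto dest: refl_onD)
  moreover have "(y, z) \<notin> r"
    using an z by (auto dest: antisymD)
  moreover have "{w \<in> P. (w, z) \<in> r} \<subseteq> {w \<in> P. (w, y) \<in> r}"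
    using tr z by (auto dest: transD)
  ultimately have "{w \<in> P. (w, z) \<in> r} \<subset> {w \<in> P. (w, y) \<in> r}"
    by blast
  then show ?case
    using fin by (simp add: psubset_card_mono)
qed

declare moebius.simps [simp del]

text \<open>
  Moebius inversion is from above, hence the converse order. The maximum \<open>A = A/\<emptyset>\<close> of the poset is
  \<open>contract_arcs D {}\<close>, a copy of \<open>D\<close> whose vertices are the singletons.
\<close>

definition psi_NL :: "('a, 'b) pre_digraph \<Rightarrow> int poly" where
  "psi_NL D =
     (\<Sum>Y \<in> dicycle_contractions D.
        monom (moebius (dicycle_contractions D) ((contraction_order D)\<inverse>) (contract_arcs D {}) Y)
          (digraph_rank Y))"

end

theory Submission
  imports Defs
begin

text \<open>
  Coflows are exactly the coboundaries of potentials on the vertices, and a potential is determined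
  by its coboundary up to a constant on each weak component. A coflow trivial on \<open>C\<close> is a coboundary
  of the contraction \<open>A/C\<close>, so there are \<open>k\<close> to the power \<open>rk(A/C)\<close> of them. For a coflow \<open>g\<close>, the
  members of \<open>dicycle_unions\<close> on which \<open>g\<close> is trivial are those contained in the largest such union
  \<open>M g\<close>, and \<open>g\<close> is an NL-coflow iff \<open>M g\<close> is empty. Moebius inversion then gives the count.
\<close>

section \<open>Restricting the arc set\<close>

lemma cas_restrict_arcs:
  "pre_digraph.cas (D\<lparr>arcs := B\<rparr>) u p v \<longleftrightarrow> pre_digraph.cas D u p v"
  by (induction p arbitrary: u) (simp_all add: pre_digraph.cas.simps)

lemma awalk_verts_restrict_arcs:
  "pre_digraph.awalk_verts (D\<lparr>arcs := B\<rparr>) u p = pre_digraph.awalk_verts D u p"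
  by (simp add: pre_digraph.awalk_verts_conv)

lemma awalk_restrict_arcs:
  assumes "B \<subseteq> arcs D"
  shows "pre_digraph.awalk (D\<lparr>arcs := B\<rparr>) u p v \<longleftrightarrow> pre_digraph.awalk D u p v \<and> set p \<subseteq> B"
  using assms by (auto simp: pre_digraph.awalk_def cas_restrict_arcs)

lemma cycle_restrict_arcs:
  assumes "B \<subseteq> arcs D"
  shows "pre_digraph.cycle (D\<lparr>arcs := B\<rparr>) p \<longleftrightarrow> pre_digraph.cycle D p \<and> set p \<subseteq> B"
  using awalk_restrict_arcs[OF assms]
  by (auto simp: pre_digraph.cycle_def awalk_verts_restrict_arcs)

lemma fin_digraph_restrict_arcs:
  assumes "fin_digraph D" "B \<subseteq> arcs D"
  shows "fin_digraph (D\<lparr>arcs := B\<rparr>)"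
proof -
  interpret fin_digraph D by fact
  show ?thesis
    using assms(2) finite_subset[OF assms(2)] by unfold_locales auto
qed

lemma cycle_arcs:
  "pre_digraph.cycle D p \<Longrightarrow> p \<noteq> [] \<and> set p \<subseteq> arcs D"
  by (auto simp: pre_digraph.cycle_def pre_digraph.awalk_def)

section \<open>Traversals and weak components\<close>

lemma traversals_simps [simp]:
  "verts (traversals D) = verts D"
  "arcs (traversals D) = arcs D \<times> UNIV"
  "tail (traversals D) (a, d) = (if d then tail D a else head D a)"
  "head (traversals D) (a, d) = (if d then head D a else tail D a)"
  by (simp_all add: traversals_def)

lemma traversals_restrict_arcs:
  "traversals (D\<lparr>arcs := B\<rparr>) = (traversals D)\<lparr>arcs := B \<times> UNIV\<rparr>"
  by (auto simp: traversals_def fun_eq_iff)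

lemma wf_digraph_traversals:
  assumes "wf_digraph D"
  shows "wf_digraph (traversals D)"
proof -
  interpret wf_digraph D by fact
  show ?thesis by unfold_locales auto
qed

lemma arcs_ends_traversals:
  "arcs_ends (traversals D) = (\<Union>e\<in>arcs D. {(tail D e, head D e), (head D e, tail D e)})"
  by (force simp: arcs_ends_conv)

lemma symmetric_traversals: "symmetric (traversals D)"
  by (auto simp: symmetric_def arcs_ends_traversals intro: symI)

text \<open>Both digraphs have the same symmetric adjacency relation. Paths in
  \<open>traversals D\<close> also record the arc and direction of every step, so that coflow
  products can be evaluated along them.\<close>

lemma weak_component_conv_traversals:
  "weak_component D v = {w. v \<rightarrow>\<^sup>*\<^bsub>traversals D\<^esub> w}"
  by (simp add: weak_component_def reachable_def arcs_ends_traversals parcs_mk_symmetric)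

section \<open>Weak components as equivalence classes\<close>

lemma weak_component_refl:
  assumes "v \<in> verts D"
  shows "v \<in> weak_component D v"
  using assms by (simp add: weak_component_conv_traversals reachable_def)

lemma weak_component_subset_verts:
  "weak_component D v \<subseteq> verts D"
  by (auto simp: weak_component_conv_traversals elim: reachable_in_vertsE)

lemma weak_component_eq:
  assumes "wf_digraph D" "w \<in> weak_component D v"
  shows "weak_component D w = weak_component D v"
proof -
  interpret T: wf_digraph "traversals D"
    using assms(1) by (rule wf_digraph_traversals)
  have "v \<rightarrow>\<^sup>*\<^bsub>traversals D\<^esub> w"
    using assms(2) by (simp add: weak_component_conv_traversals)
  moreover from this have "w \<rightarrow>\<^sup>*\<^bsub>traversals D\<^esub> v"
    by (rule symmetric_reachable[OF symmetric_traversals])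
  ultimately show ?thesis
    by (auto simp: weak_component_conv_traversals intro: T.reachable_trans)
qed

lemma weak_component_head_eq_tail:
  assumes "wf_digraph D" "a \<in> arcs D"
  shows "weak_component D (head D a) = weak_component D (tail D a)"
proof -
  interpret T: wf_digraph "traversals D"
    using assms(1) by (rule wf_digraph_traversals)
  have "tail D a \<rightarrow>\<^bsub>traversals D\<^esub> head D a"
    using assms(2) by (auto simp: arcs_ends_traversals)
  then show ?thesis
    using assms(1) by (intro weak_component_eq) (auto simp: weak_component_conv_traversals)
qed

text \<open>Induction along a connecting walk. It serves twice: for the quotient of two potentials
  with equal coboundary, and for a potential that passes to a contraction.\<close>

lemma weak_component_const:
  assumes "wf_digraph D" "\<And>a. a \<in> arcs D \<Longrightarrow> f (head D a) = f (tail D a)"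
    and "w \<in> weak_component D v"
  shows "f w = f v"
proof -
  interpret T: wf_digraph "traversals D"
    using assms(1) by (rule wf_digraph_traversals)
  have "v \<rightarrow>\<^sup>*\<^bsub>traversals D\<^esub> w"
    using assms(3) by (simp add: weak_component_conv_traversals)
  then show ?thesis
    by (induction rule: T.reachable_induct) (auto simp: arcs_ends_traversals assms(2))
qed

lemma fin_digraph_contract_arcs:
  assumes "fin_digraph D"
  shows "fin_digraph (contract_arcs D C)"
proof -
  interpret D: fin_digraph D by fact
  show ?thesis
    by unfold_locales (auto simp: contract_arcs_def weak_components_def)
qed

text \<open>A second use of an arc, in either direction, would pass through the vertex where its
  first use started. So a simple path meets the distinctness condition of
  \<open>weak_cycle\<close>.\<close>

lemma apath_traversals_distinct_arcs:
  assumes "wf_digraph D" "pre_digraph.apath (traversals D) u p v"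
  shows "distinct (map fst p)"
proof -
  interpret T: wf_digraph "traversals D"
    using assms(1) by (rule wf_digraph_traversals)
  show ?thesis
    using assms(2)
  proof (induction p arbitrary: u)
    case Nil
    then show ?case by simp
  next
    case (Cons e p)
    then have p: "T.apath (head (traversals D) e) p v"
      and notin: "tail (traversals D) e \<notin> set (T.awalk_verts (head (traversals D) e) p)"
      by (auto simp: T.apath_Cons_iff)
    have walk: "T.awalk (head (traversals D) e) p v"
      using p by (rule T.awalkI_apath)
    have "fst e \<noteq> fst e'" if "e' \<in> set p" for e'
    proof
      assume eq: "fst e = fst e'"
      have "tail (traversals D) e' \<in> set (T.awalk_verts (head (traversals D) e) p)"
        "head (traversals D) e' \<in> set (T.awalk_verts (head (traversals D) e) p)"
        using T.awalk_verts_arc1[OF that] T.awalk_verts_arc2[OF walk that] by auto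
      moreover have "tail (traversals D) e \<in> {tail (traversals D) e', head (traversals D) e'}"
        using eq by (cases e; cases e') auto
      ultimately show False
        using notin by auto
    qed
    then show ?case
      using Cons.IH[OF p] by force
  qed
qed

text \<open>The path stays in \<open>B\<close> and so avoids \<open>a\<close>; if \<open>a\<close>
  is a loop, the path is empty. This supplies the weak cycle used when a potential is extended to
  \<open>a\<close>.\<close>

lemma weak_cycle_insert_arc:
  assumes "wf_digraph D" "B \<subseteq> arcs D" "a \<in> arcs D - B"
    and "pre_digraph.apath (traversals (D\<lparr>arcs := B\<rparr>)) (head D a) p (tail D a)"
  shows "weak_cycle D ((a, True) # p)"
proof -
  interpret D: wf_digraph D by fact
  interpret T: wf_digraph "traversals D"
    using assms(1) by (rule wf_digraph_traversals)
  have B: "B \<times> UNIV \<subseteq> arcs (traversals D)"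
    using assms(2) by auto
  have p: "T.awalk (head D a) p (tail D a)" "set p \<subseteq> B \<times> UNIV"
    "distinct (T.awalk_verts (head D a) p)"
    using assms(4) awalk_restrict_arcs[OF B]
    by (auto simp: pre_digraph.apath_def traversals_restrict_arcs awalk_verts_restrict_arcs)
  then have "T.apath (head D a) p (tail D a)"
    by (simp add: T.apath_def)
  then have "distinct (map fst p)"
    by (rule apath_traversals_distinct_arcs[OF assms(1)])
  moreover have "a \<notin> fst ` set p"
    using p(2) assms(3) by auto
  moreover have "T.cycle ((a, True) # p)"
    using p assms(3) by (auto simp: T.cycle_def T.awalk_Cons_iff)
  ultimately show ?thesis
    by (simp add: weak_cycle_def)
qed

section \<open>Forward and backward arc sets\<close>

lemma forward_arcs_simps [simp]:
  "forward_arcs [] = {}"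
  "forward_arcs ((a, True) # p) = insert a (forward_arcs p)"
  "forward_arcs ((a, False) # p) = forward_arcs p"
  by (auto simp: forward_arcs_def)

lemma backward_arcs_simps [simp]:
  "backward_arcs [] = {}"
  "backward_arcs ((a, True) # p) = backward_arcs p"
  "backward_arcs ((a, False) # p) = insert a (backward_arcs p)"
  by (auto simp: backward_arcs_def)

lemma forward_arcs_subset: "forward_arcs p \<subseteq> fst ` set p"
  by (force simp: forward_arcs_def)

lemma backward_arcs_subset: "backward_arcs p \<subseteq> fst ` set p"
  by (force simp: backward_arcs_def)

lemma finite_forward_arcs [simp]: "finite (forward_arcs p)"
  by (rule finite_subset[OF forward_arcs_subset]) simp

lemma finite_backward_arcs [simp]: "finite (backward_arcs p)"
  by (rule finite_subset[OF backward_arcs_subset]) simp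

section \<open>Coflows are coboundaries of potentials\<close>

text \<open>Restricted to the arcs because coflows are extensional maps, so that the two can be
  equal as functions.\<close>

definition coboundary ::
    "('a, 'b) pre_digraph \<Rightarrow> ('g, 'm) monoid_scheme \<Rightarrow> ('a \<Rightarrow> 'g) \<Rightarrow> 'b \<Rightarrow> 'g" where
  "coboundary D G f = (\<lambda>a\<in>arcs D. f (head D a) \<otimes>\<^bsub>G\<^esub> inv\<^bsub>G\<^esub> f (tail D a))"

context comm_group
begin

text \<open>Telescoping, cross-multiplied so that no inverses occur. Distinctness of the arcs makes
  products over arc sets, which forget multiplicity, agree with products along the walk.\<close>

lemma potential_along_walk:
  assumes "wf_digraph D" "g \<in> arcs D \<rightarrow> carrier G" "f \<in> verts D \<rightarrow> carrier G"
    and pot: "\<And>a. a \<in> arcs D \<Longrightarrow> g a \<otimes> f (tail D a) = f (head D a)"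
    and "pre_digraph.awalk (traversals D) u p v" "distinct (map fst p)"
  shows "f u \<otimes> finprod G g (forward_arcs p) = f v \<otimes> finprod G g (backward_arcs p)"
proof -
  interpret D: wf_digraph D by fact
  interpret T: wf_digraph "traversals D"
    using assms(1) by (rule wf_digraph_traversals)
  show ?thesis
    using assms(5,6)
  proof (induction p arbitrary: u)
    case Nil
    then show ?case by (auto simp: T.awalk_Nil_iff)
  next
    case (Cons e p)
    obtain a d where e: "e = (a, d)" by (cases e)
    have a: "a \<in> arcs D" and u: "u = tail (traversals D) e"
      and walk: "T.awalk (head (traversals D) e) p v"
      using Cons.prems e by (auto simp: T.awalk_Cons_iff)
    have dist: "a \<notin> fst ` set p" "distinct (map fst p)"
      using Cons.prems(2) e by auto
    have sub: "fst ` set p \<subseteq> arcs D"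
      using walk by (auto simp: T.awalk_def)
    have g: "g \<in> forward_arcs p \<rightarrow> carrier G" "g \<in> backward_arcs p \<rightarrow> carrier G"
      using assms(2) sub forward_arcs_subset[of p] backward_arcs_subset[of p] by blast+
    have notin: "a \<notin> forward_arcs p" "a \<notin> backward_arcs p"
      using dist forward_arcs_subset[of p] backward_arcs_subset[of p] by blast+
    have carr: "g a \<in> carrier G" "f (tail D a) \<in> carrier G" "f (head D a) \<in> carrier G"
      "f v \<in> carrier G"
      "finprod G g (forward_arcs p) \<in> carrier G" "finprod G g (backward_arcs p) \<in> carrier G"
      using assms(2,3) a g T.awalk_last_in_verts[OF walk] by auto
    note IH = Cons.IH[OF walk dist(2)]
    show ?case
    proof (cases d)
      case True
      have "f (tail D a) \<otimes> (g a \<otimes> finprod G g (forward_arcs p))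
          = f (head D a) \<otimes> finprod G g (forward_arcs p)"
        using carr pot[OF a, symmetric] by (simp add: m_ac)
      then show ?thesis
        using IH True e u g notin carr by (simp add: finprod_insert)
    next
      case False
      have "f (head D a) \<otimes> finprod G g (forward_arcs p)
          = g a \<otimes> (f (tail D a) \<otimes> finprod G g (forward_arcs p))"
        using carr pot[OF a, symmetric] by (simp add: m_ac)
      also have "\<dots> = f v \<otimes> (g a \<otimes> finprod G g (backward_arcs p))"
        using IH False e carr by (simp add: m_ac)
      finally show ?thesis
        using False e u g notin carr by (simp add: finprod_insert)
    qed
  qed
qed

lemma coboundary_potential:
  assumes "wf_digraph D" "f \<in> verts D \<rightarrow> carrier G" "a \<in> arcs D"
  shows "coboundary D G f a \<otimes> f (tail D a) = f (head D a)"
proof -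
  interpret D: wf_digraph D by fact
  have "f (tail D a) \<in> carrier G" "f (head D a) \<in> carrier G"
    using assms(2,3) by auto
  then show ?thesis
    using assms(3) by (simp add: coboundary_def m_assoc)
qed

lemma coboundary_in_carrier:
  assumes "wf_digraph D" "f \<in> verts D \<rightarrow> carrier G"
  shows "coboundary D G f \<in> arcs D \<rightarrow>\<^sub>E carrier G"
proof -
  interpret D: wf_digraph D by fact
  show ?thesis
    using assms(2) by (auto simp: coboundary_def intro!: m_closed inv_closed)
qed

text \<open>On a closed walk both sides of the telescoped equation carry the same factor
  \<open>f u\<close>, which cancels.\<close>

lemma coflow_coboundary:
  assumes "wf_digraph D" "f \<in> verts D \<rightarrow> carrier G"
  shows "coflow D G (coboundary D G f)"
  unfolding coflow_def
proof (intro conjI allI impI)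
  interpret T: wf_digraph "traversals D"
    using assms(1) by (rule wf_digraph_traversals)
  show in_carrier: "coboundary D G f \<in> arcs D \<rightarrow>\<^sub>E carrier G"
    using assms by (rule coboundary_in_carrier)
  fix p
  assume "weak_cycle D p"
  then obtain u where walk: "T.awalk u p u" and dist: "distinct (map fst p)"
    by (auto simp: weak_cycle_def T.cycle_def)
  have sub: "fst ` set p \<subseteq> arcs D"
    using walk by (auto simp: T.awalk_def)
  have g: "coboundary D G f \<in> forward_arcs p \<rightarrow> carrier G"
    "coboundary D G f \<in> backward_arcs p \<rightarrow> carrier G"
    using in_carrier sub forward_arcs_subset[of p] backward_arcs_subset[of p] by blast+
  have "f u \<otimes> finprod G (coboundary D G f) (forward_arcs p)
      = f u \<otimes> finprod G (coboundary D G f) (backward_arcs p)"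
    using in_carrier by (intro potential_along_walk[OF assms(1) _ assms(2) _ walk dist]
        coboundary_potential[OF assms]) auto
  moreover have "f u \<in> carrier G"
    using assms(2) T.awalk_hd_in_verts[OF walk] by auto
  ultimately show "finprod G (coboundary D G f) (forward_arcs p)
      = finprod G (coboundary D G f) (backward_arcs p)"
    using g by simp
qed

text \<open>
  Arcs are added one at a time. An arc joining two vertices that are already connected closes a
  weak cycle, which forces the right value; otherwise the potential is shifted on the component of
  the head.
\<close>

lemma coflow_potential_exists:
  assumes "fin_digraph D" "coflow D G g"
    and "finite B" "B \<subseteq> arcs D"
  shows "\<exists>f \<in> verts D \<rightarrow> carrier G. \<forall>a\<in>B. g a \<otimes> f (tail D a) = f (head D a)"
  using assms(3,4)
proof (induction B rule: finite_induct)
  case empty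
  then show ?case by (auto intro!: bexI[of _ "\<lambda>_. \<one>"])
next
  case (insert a B)
  interpret D: fin_digraph D by fact
  let ?DB = "D\<lparr>arcs := B\<rparr>"
  interpret DB: fin_digraph ?DB
    using fin_digraph_restrict_arcs[OF assms(1)] insert.prems by auto
  interpret T: wf_digraph "traversals ?DB"
    using DB.wf_digraph by (rule wf_digraph_traversals)
  have a: "a \<in> arcs D - B" "a \<in> arcs D" and B: "B \<subseteq> arcs D"
    using insert by auto
  obtain f where f: "f \<in> verts D \<rightarrow> carrier G"
    and pot: "\<And>b. b \<in> B \<Longrightarrow> g b \<otimes> f (tail D b) = f (head D b)"
    using insert.IH B by auto
  have g: "g \<in> arcs D \<rightarrow> carrier G"
    using assms(2) by (auto simp: coflow_def)
  have ends: "f (tail D b) \<in> carrier G" "f (head D b) \<in> carrier G" "g b \<in> carrier G"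
    if "b \<in> arcs D" for b
    using f g that by auto
  show ?case
  proof (cases "tail D a \<in> weak_component ?DB (head D a)")
    case True
    then obtain p where p: "T.apath (head D a) p (tail D a)"
      by (auto simp: weak_component_conv_traversals T.reachable_apath)
    have walk: "T.awalk (head D a) p (tail D a)"
      using p by (rule T.awalkI_apath)
    have sub: "fst ` set p \<subseteq> B"
      using walk by (auto simp: T.awalk_def)
    have gp: "g \<in> forward_arcs p \<rightarrow> carrier G" "g \<in> backward_arcs p \<rightarrow> carrier G"
      using g B sub forward_arcs_subset[of p] backward_arcs_subset[of p] by blast+
    have "a \<notin> forward_arcs p"
      using a(1) sub forward_arcs_subset[of p] by blast
    moreover have "weak_cycle D ((a, True) # p)"
      using D.wf_digraph B a(1) p by (rule weak_cycle_insert_arc)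
    ultimately have cyc: "g a \<otimes> finprod G g (forward_arcs p) = finprod G g (backward_arcs p)"
      using assms(2) gp ends[OF a(2)] by (force simp: coflow_def finprod_insert)
    have "f (head D a) \<otimes> finprod G g (forward_arcs p)
        = f (tail D a) \<otimes> finprod G g (backward_arcs p)"
      using f g B pot by (intro potential_along_walk[OF DB.wf_digraph _ _ _ walk
          apath_traversals_distinct_arcs[OF DB.wf_digraph p]]) auto
    \<comment> \<open>The cycle equation \<open>cyc\<close> trades the backward product for the
      forward one, which can then be cancelled.\<close>
    also have "\<dots> = (g a \<otimes> f (tail D a)) \<otimes> finprod G g (forward_arcs p)"
      using ends[OF a(2)] gp by (simp add: cyc[symmetric] m_ac)
    finally have "g a \<otimes> f (tail D a) = f (head D a)"
      using ends[OF a(2)] gp by simp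
    then show ?thesis
      using f pot by auto
  next
    case False
    \<comment> \<open>This factor solves the equation of \<open>a\<close> for the shifted head value
      \<open>c \<otimes> f (head D a)\<close>; the tail lies outside the component and keeps its
      value.\<close>
    define c where "c = g a \<otimes> f (tail D a) \<otimes> inv (f (head D a))"
    let ?K = "weak_component ?DB (head D a)"
    let ?f = "\<lambda>v. if v \<in> ?K then c \<otimes> f v else f v"
    have c: "c \<in> carrier G" and c_head: "c \<otimes> f (head D a) = g a \<otimes> f (tail D a)"
      using ends[OF a(2)] by (auto simp: c_def m_assoc)
    have "?f \<in> verts D \<rightarrow> carrier G"
      using c funcset_mem[OF f] by simp
    moreover have "g b \<otimes> ?f (tail D b) = ?f (head D b)" if b: "b \<in> insert a B" for b
    proof (cases "b = a")
      case True
      have "head D a \<in> ?K"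
        using a(2) by (intro weak_component_refl) auto
      then show ?thesis
        using True False c_head by simp
    next
      case neq: False
      then have bB: "b \<in> B" "b \<in> arcs D"
        using b B by auto
      \<comment> \<open>Both ends of an arc of \<open>B\<close> lie in one component, so both or
        neither are shifted and its equation survives.\<close>
      have "weak_component ?DB (head D b) = weak_component ?DB (tail D b)"
        using weak_component_head_eq_tail[OF DB.wf_digraph, of b] bB by simp
      moreover have "v \<in> ?K \<longleftrightarrow> weak_component ?DB v = ?K" if "v \<in> verts D" for v
      proof
        show "weak_component ?DB v = ?K" if "v \<in> ?K"
          using DB.wf_digraph that by (rule weak_component_eq)
        have "v \<in> weak_component ?DB v"
          using that by (intro weak_component_refl) simp
        then show "v \<in> ?K" if "weak_component ?DB v = ?K"
          by (simp only: that)
      qed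
      ultimately have in_K: "tail D b \<in> ?K \<longleftrightarrow> head D b \<in> ?K"
        using bB(2) by (metis D.tail_in_verts D.head_in_verts)
      show ?thesis
      proof (cases "tail D b \<in> ?K")
        case True
        then show ?thesis
          using in_K c ends[OF bB(2)] by (simp add: m_lcomm pot[OF bB(1)])
      next
        case False
        then show ?thesis
          using in_K by (simp add: pot[OF bB(1)])
      qed
    qed
    ultimately show ?thesis
      by (intro bexI[of _ ?f]) auto
  qed
qed

text \<open>Applies the arc-by-arc construction to the full arc set. From here on coflows are
  counted through potentials.\<close>

lemma coflow_iff_coboundary:
  assumes "fin_digraph D"
  shows "coflow D G g \<longleftrightarrow> (\<exists>f \<in> verts D \<rightarrow> carrier G. g = coboundary D G f)"
proof
  interpret D: fin_digraph D by fact
  assume coflow: "coflow D G g"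
  then obtain f where f: "f \<in> verts D \<rightarrow> carrier G"
    and pot: "\<And>a. a \<in> arcs D \<Longrightarrow> g a \<otimes> f (tail D a) = f (head D a)"
    using coflow_potential_exists[OF assms coflow D.finite_arcs] by auto
  have g: "g \<in> arcs D \<rightarrow>\<^sub>E carrier G"
    using coflow by (simp add: coflow_def)
  have "g = coboundary D G f"
  proof (rule PiE_ext[OF g])
    show "coboundary D G f \<in> arcs D \<rightarrow>\<^sub>E carrier G"
      using D.wf_digraph f by (rule coboundary_in_carrier)
    fix a
    assume a: "a \<in> arcs D"
    have carr: "g a \<in> carrier G" "f (tail D a) \<in> carrier G"
      using f g a by auto
    then show "g a = coboundary D G f a"
      using a pot[OF a, symmetric] by (simp add: coboundary_def m_assoc)
  qed
  then show "\<exists>f \<in> verts D \<rightarrow> carrier G. g = coboundary D G f"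
    using f by auto
next
  interpret D: fin_digraph D by fact
  assume "\<exists>f \<in> verts D \<rightarrow> carrier G. g = coboundary D G f"
  then show "coflow D G g"
    using coflow_coboundary[OF D.wf_digraph] by auto
qed

section \<open>Counting coflows\<close>

lemma mult_inv_eq_iff:
  assumes "x \<in> carrier G" "y \<in> carrier G" "z \<in> carrier G" "w \<in> carrier G"
  shows "x \<otimes> inv y = z \<otimes> inv w \<longleftrightarrow> x \<otimes> w = z \<otimes> y"
proof -
  have "x \<otimes> inv y = z \<otimes> inv w \<longleftrightarrow> x = z \<otimes> inv w \<otimes> y"
    using assms by (intro inv_solve_right') auto
  also have "z \<otimes> inv w \<otimes> y = z \<otimes> y \<otimes> inv w"
    using assms by (simp add: m_ac)
  also have "x = \<dots> \<longleftrightarrow> z \<otimes> y = x \<otimes> w"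
    using assms by (intro inv_solve_right) auto
  finally show ?thesis by auto
qed

text \<open>The middle terms of two equal quotients are exchanged. The result is the hypothesis of
  \<open>weak_component_const\<close> for the quotient of \<open>f\<close> and
  \<open>h\<close>.\<close>

lemma coboundary_cong_iff:
  assumes "wf_digraph D" "f \<in> verts D \<rightarrow> carrier G" "h \<in> verts D \<rightarrow> carrier G"
  shows "coboundary D G f = coboundary D G h \<longleftrightarrow>
    (\<forall>a\<in>arcs D. f (head D a) \<otimes> inv h (head D a) = f (tail D a) \<otimes> inv h (tail D a))"
proof -
  interpret D: wf_digraph D by fact
  have "x \<otimes> inv y = z \<otimes> inv w \<longleftrightarrow> x \<otimes> inv z = y \<otimes> inv w"
    if "x \<in> carrier G" "y \<in> carrier G" "z \<in> carrier G" "w \<in> carrier G" for x y z w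
    using that by (simp add: mult_inv_eq_iff m_comm)
  moreover have "f v \<in> carrier G" "h v \<in> carrier G" if "v \<in> verts D" for v
    using assms(2,3) that by auto
  ultimately show ?thesis
    by (auto simp: coboundary_def fun_eq_iff restrict_def)
qed

text \<open>The coboundary ignores one constant per weak component. So a potential can be normalised
  to \<one> at one chosen vertex of each component; its values at the remaining vertices are then
  free and determined by the coboundary.\<close>

lemma card_coboundaries:
  assumes "fin_digraph D" "finite (carrier G)"
  shows "card (coboundary D G ` (verts D \<rightarrow> carrier G)) = Coset.order G ^ digraph_rank D"
proof -
  interpret D: fin_digraph D by fact
  define rep :: "'c set \<Rightarrow> 'c" where "rep K = (SOME v. v \<in> K)" for K
  define R where "R = rep ` weak_components D"
  define root where "root v = rep (weak_component D v)" for v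
  have root: "root v \<in> weak_component D v" if "v \<in> verts D" for v
    unfolding root_def rep_def using weak_component_refl[OF that] by (rule someI)
  have root_R: "root v \<in> R" if "v \<in> verts D" for v
    using that by (auto simp: R_def root_def weak_components_def)
  have R_verts: "R \<subseteq> verts D"
    using root weak_component_subset_verts[of D]
    by (fastforce simp: R_def weak_components_def simp flip: root_def)
  have root_id: "root v = v" if v: "v \<in> R" for v
  proof -
    obtain w where "w \<in> verts D" "v = root w"
      using v by (auto simp: R_def weak_components_def root_def)
    then show ?thesis
      using weak_component_eq[OF D.wf_digraph root[of w]] by (simp add: root_def)
  qed
  have root_arc: "root (head D a) = root (tail D a)" if "a \<in> arcs D" for a
    using weak_component_head_eq_tail[OF D.wf_digraph that] by (simp add: root_def)
  \<comment> \<open>Components with equal representatives share a vertex and coincide. Thus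
    \<open>R\<close> has exactly one vertex per component.\<close>
  have "inj_on rep (weak_components D)"
  proof (rule inj_onI)
    fix K L
    assume "K \<in> weak_components D" "L \<in> weak_components D" and eq: "rep K = rep L"
    then obtain v w where vw: "v \<in> verts D" "w \<in> verts D"
      and KL: "K = weak_component D v" "L = weak_component D w"
      by (auto simp: weak_components_def)
    have "root v = root w"
      using eq by (simp add: KL root_def)
    then show "K = L"
      using weak_component_eq[OF D.wf_digraph root[OF vw(1)]]
        weak_component_eq[OF D.wf_digraph root[OF vw(2)]] KL
      by metis
  qed
  then have card_R: "card R = card (weak_components D)"
    by (simp add: R_def card_image)
  define ext where "ext h v = (if v \<in> R then \<one> else h v)" for h :: "'c \<Rightarrow> 'a" and v
  have ext: "ext h \<in> verts D \<rightarrow> carrier G" if "h \<in> (verts D - R) \<rightarrow>\<^sub>E carrier G" for h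
    using PiE_mem[OF that] by (simp add: ext_def)
  have "bij_betw (\<lambda>h. coboundary D G (ext h)) ((verts D - R) \<rightarrow>\<^sub>E carrier G)
      (coboundary D G ` (verts D \<rightarrow> carrier G))"
    unfolding bij_betw_def
  proof (intro conjI inj_onI subset_antisym subsetI)
    fix h h'
    assume h: "h \<in> (verts D - R) \<rightarrow>\<^sub>E carrier G" and h': "h' \<in> (verts D - R) \<rightarrow>\<^sub>E carrier G"
      and eq: "coboundary D G (ext h) = coboundary D G (ext h')"
    show "h = h'"
    proof (rule PiE_ext[OF h h'])
      fix v
      assume v: "v \<in> verts D - R"
      \<comment> \<open>The quotient of the two potentials is constant on the component, and at the
        root it is \<one>.\<close>
      have "ext h (root v) \<otimes> inv ext h' (root v) = ext h v \<otimes> inv ext h' v"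
      proof (rule weak_component_const[OF D.wf_digraph, where f = "\<lambda>v. ext h v \<otimes> inv ext h' v"])
        show "root v \<in> weak_component D v"
          using v by (intro root) simp
        show "ext h (head D a) \<otimes> inv ext h' (head D a) = ext h (tail D a) \<otimes> inv ext h' (tail D a)"
          if "a \<in> arcs D" for a
          using eq that by (rule coboundary_cong_iff[OF D.wf_digraph ext[OF h] ext[OF h'],
                THEN iffD1, rule_format])
      qed
      moreover have "ext h (root v) = \<one>" "ext h' (root v) = \<one>"
        using root_R[of v] v by (auto simp: ext_def)
      ultimately have "h v \<otimes> inv h' v = \<one>"
        using v by (auto simp: ext_def)
      moreover have "h v \<in> carrier G" "h' v \<in> carrier G"
        using h h' v by auto
      ultimately show "h v = h' v"
        by (metis inv_equality inv_inv inv_closed)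
    qed
  next
    fix g
    assume "g \<in> (\<lambda>h. coboundary D G (ext h)) ` ((verts D - R) \<rightarrow>\<^sub>E carrier G)"
    then show "g \<in> coboundary D G ` (verts D \<rightarrow> carrier G)"
      using ext by auto
  next
    fix g
    assume "g \<in> coboundary D G ` (verts D \<rightarrow> carrier G)"
    then obtain f where f: "f \<in> verts D \<rightarrow> carrier G" and g: "g = coboundary D G f"
      by auto
    \<comment> \<open>Dividing by the value at the root normalises \<open>f\<close>; the divisor is
      constant on each component, so the coboundary is unchanged.\<close>
    let ?h = "\<lambda>v\<in>verts D - R. f v \<otimes> inv f (root v)"
    have root_verts: "root v \<in> verts D" if "v \<in> verts D" for v
      using root_R[OF that] R_verts by auto
    have carr: "f v \<in> carrier G" "f (root v) \<in> carrier G" if "v \<in> verts D" for v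
      using f that root_verts[OF that] by auto
    have h: "?h \<in> (verts D - R) \<rightarrow>\<^sub>E carrier G"
      using carr by auto
    have "ext ?h v = f v \<otimes> inv f (root v)" if "v \<in> verts D" for v
      using that carr[OF that] by (auto simp: ext_def root_id)
    then have "f v \<otimes> inv (ext ?h v) = f (root v)" if "v \<in> verts D" for v
      using that carr[OF that]
      by (simp add: inv_solve_right' m_lcomm[of "f (root v)" "f v"])
    then have "coboundary D G f = coboundary D G (ext ?h)"
      by (subst coboundary_cong_iff[OF D.wf_digraph f ext[OF h]]) (simp add: root_arc)
    then show "g \<in> (\<lambda>h. coboundary D G (ext h)) ` ((verts D - R) \<rightarrow>\<^sub>E carrier G)"
      using g h by blast
  qed
  then have "card (coboundary D G ` (verts D \<rightarrow> carrier G))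
      = card ((verts D - R) \<rightarrow>\<^sub>E carrier G)"
    by (simp add: bij_betw_same_card)
  also have "\<dots> = Coset.order G ^ card (verts D - R)"
    by (simp add: card_PiE Coset.order_def)
  also have "card (verts D - R) = digraph_rank D"
    using R_verts by (simp add: card_Diff_subset finite_subset[OF R_verts] card_R digraph_rank_def)
  finally show ?thesis .
qed

text \<open>A potential whose coboundary is trivial on \<open>C\<close> is constant on the classes
  identified by the contraction, so it descends; conversely, a potential of the contraction pulls
  back. Restriction to \<open>arcs D - C\<close> is the resulting bijection with the coboundaries of
  the contraction.\<close>

lemma card_coflows_trivial_on:
  assumes "fin_digraph D" "finite (carrier G)" "C \<subseteq> arcs D"
  shows "card {g. coflow D G g \<and> (\<forall>a\<in>C. g a = \<one>)}
    = Coset.order G ^ digraph_rank (contract_arcs D C)"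
proof -
  interpret D: fin_digraph D by fact
  let ?E = "contract_arcs D C"
  let ?DC = "D\<lparr>arcs := C\<rparr>"
  interpret E: fin_digraph ?E
    using assms(1) by (rule fin_digraph_contract_arcs)
  interpret DC: fin_digraph ?DC
    using assms(1,3) by (rule fin_digraph_restrict_arcs)
  let ?S = "{g. coflow D G g \<and> (\<forall>a\<in>C. g a = \<one>)}"
  let ?r = "\<lambda>g. restrict g (arcs D - C)"
  have comp: "weak_component ?DC v \<in> verts ?E" if "v \<in> verts D" for v
    using that by (auto simp: contract_arcs_def weak_components_def)
  have "bij_betw ?r ?S (coboundary ?E G ` (verts ?E \<rightarrow> carrier G))"
    unfolding bij_betw_def
  proof (intro conjI inj_onI subset_antisym subsetI)
    fix g h
    assume g: "g \<in> ?S" and h: "h \<in> ?S" and eq: "?r g = ?r h"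
    have "g \<in> arcs D \<rightarrow>\<^sub>E carrier G" "h \<in> arcs D \<rightarrow>\<^sub>E carrier G"
      using g h by (auto simp: coflow_def)
    then show "g = h"
    proof (rule PiE_ext)
      fix a
      assume "a \<in> arcs D"
      \<comment> \<open>Restriction loses only the values on \<open>C\<close>, and these are
        \<one>.\<close>
      then show "g a = h a"
        using g h fun_cong[OF eq, of a] by (cases "a \<in> C") auto
    qed
  next
    fix g'
    assume "g' \<in> ?r ` ?S"
    then obtain g where g: "coflow D G g" "\<And>a. a \<in> C \<Longrightarrow> g a = \<one>" and g': "g' = ?r g"
      by auto
    then obtain f where f: "f \<in> verts D \<rightarrow> carrier G" and gf: "g = coboundary D G f"
      using coflow_iff_coboundary[OF assms(1)] by auto
    have f_arc: "f (head ?DC a) = f (tail ?DC a)" if a: "a \<in> arcs ?DC" for a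
    proof -
      have "a \<in> arcs D" "g a = \<one>"
        using a assms(3) g(2) by auto
      moreover from this have "f (tail D a) \<in> carrier G"
        using f by auto
      ultimately show ?thesis
        using coboundary_potential[OF D.wf_digraph f, of a] gf by simp
    qed
    \<comment> \<open>Any vertex of the class may be chosen, since \<open>f\<close> is constant on
      it.\<close>
    define h where "h K = f (SOME v. v \<in> K)" for K
    have h: "h (weak_component ?DC v) = f v" if "v \<in> verts D" for v
    proof -
      have "v \<in> weak_component ?DC v"
        using that by (intro weak_component_refl) simp
      then have "(SOME w. w \<in> weak_component ?DC v) \<in> weak_component ?DC v"
        by (rule someI)
      then show ?thesis
        unfolding h_def
        by (rule weak_component_const[OF DC.wf_digraph, where f = f, rotated]) (rule f_arc)
    qed
    then have "h \<in> verts ?E \<rightarrow> carrier G"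
      using f by (auto simp: contract_arcs_def weak_components_def)
    moreover have "g' = coboundary ?E G h"
      using h by (auto simp: g' gf coboundary_def contract_arcs_def fun_eq_iff restrict_def)
    ultimately show "g' \<in> coboundary ?E G ` (verts ?E \<rightarrow> carrier G)"
      by auto
  next
    fix g'
    assume "g' \<in> coboundary ?E G ` (verts ?E \<rightarrow> carrier G)"
    then obtain h where h: "h \<in> verts ?E \<rightarrow> carrier G" and g': "g' = coboundary ?E G h"
      by auto
    \<comment> \<open>The pull-back takes equal values at both ends of an arc of \<open>C\<close>,
      hence its coboundary is trivial there.\<close>
    let ?f = "\<lambda>v. h (weak_component ?DC v)"
    have f: "?f \<in> verts D \<rightarrow> carrier G"
      using h comp by auto
    have "coboundary D G ?f a = \<one>" if "a \<in> C" for a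
    proof -
      have a: "a \<in> arcs D"
        using assms(3) that by auto
      then have "?f (tail D a) \<in> carrier G"
        using f by auto
      then show ?thesis
        using a weak_component_head_eq_tail[OF DC.wf_digraph, of a] that
        by (simp add: coboundary_def)
    qed
    moreover have "coflow D G (coboundary D G ?f)"
      using D.wf_digraph f by (rule coflow_coboundary)
    moreover have "g' = ?r (coboundary D G ?f)"
      by (auto simp: g' coboundary_def contract_arcs_def fun_eq_iff restrict_def)
    ultimately show "g' \<in> ?r ` ?S"
      by blast
  qed
  then show ?thesis
    using card_coboundaries[OF E.fin_digraph assms(2)] by (simp add: bij_betw_same_card)
qed

end

section \<open>Moebius inversion over unions of directed cycles\<close>

text \<open>The defining recursion with its top term moved across; the hypotheses make the guard in
  \<open>moebius\<close> true.\<close>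

lemma moebius_sum:
  assumes "finite P" "partial_order_on P r" "(x, y) \<in> r"
  shows "(\<Sum>z\<in>{z \<in> P. (x, z) \<in> r \<and> (z, y) \<in> r}. moebius P r x z) = (if x = y then 1 else 0)"
proof -
  have r: "refl_on P r" "antisym r" "r \<subseteq> P \<times> P"
    using assms(2) by (auto simp: partial_order_on_def preorder_on_def)
  then have y: "y \<in> P" "(y, y) \<in> r"
    using assms(3) by (auto dest: refl_onD)
  show ?thesis
  proof (cases "x = y")
    case True
    then have "{z \<in> P. (x, z) \<in> r \<and> (z, y) \<in> r} = {y}"
      using r y by (auto dest: antisymD)
    then show ?thesis
      using True assms y by (simp add: moebius.simps[of P r y y])
  next
    case False
    have "{z \<in> P. (x, z) \<in> r \<and> (z, y) \<in> r}
        = insert y {z \<in> P. (x, z) \<in> r \<and> (z, y) \<in> r \<and> z \<noteq> y}"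
      using y assms(3) by auto
    then show ?thesis
      using False assms by (simp add: moebius.simps[of P r x y])
  qed
qed

section \<open>The union-closed family generated by the directed cycles\<close>

lemma dicycle_unions_subset_arcs:
  "C \<in> dicycle_unions D \<Longrightarrow> C \<subseteq> arcs D"
  using cycle_arcs[of D] by (fastforce simp: dicycle_unions_def)

lemma finite_dicycle_unions:
  assumes "fin_digraph D"
  shows "finite (dicycle_unions D)"
proof -
  interpret D: fin_digraph D by fact
  show ?thesis
    by (rule finite_subset[of _ "Pow (arcs D)"]) (use dicycle_unions_subset_arcs in auto)
qed

lemma empty_in_dicycle_unions: "{} \<in> dicycle_unions D"
  by (auto simp: dicycle_unions_def intro: exI[of _ "{}"])

lemma cycle_in_dicycle_unions:
  "pre_digraph.cycle D p \<Longrightarrow> set p \<in> dicycle_unions D"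
  by (auto simp: dicycle_unions_def intro: exI[of _ "{p}"])

text \<open>This puts the union of all members on which a coflow is trivial back into the family, so
  a largest such member exists.\<close>

lemma Union_in_dicycle_unions:
  assumes "finite F" "F \<subseteq> dicycle_unions D"
  shows "\<Union>F \<in> dicycle_unions D"
  using assms
proof (induction F rule: finite_induct)
  case empty
  then show ?case by (simp add: empty_in_dicycle_unions)
next
  case (insert C F)
  then obtain P Q where "finite P" "\<forall>p\<in>P. pre_digraph.cycle D p" "C = \<Union>(set ` P)"
    "finite Q" "\<forall>p\<in>Q. pre_digraph.cycle D p" "\<Union>F = \<Union>(set ` Q)"
    by (auto simp: dicycle_unions_def)
  then show ?case
    by (auto simp: dicycle_unions_def intro!: exI[of _ "P \<union> Q"])
qed

text \<open>The arc set \<open>arcs D - C\<close> of the contraction determines \<open>C\<close>. So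
  contractions may be indexed by unions of directed cycles.\<close>

lemma inj_on_contract_arcs: "inj_on (contract_arcs D) (Pow (arcs D))"
  by (rule inj_onI) (auto simp: contract_arcs_def)

text \<open>The order is defined through some pair of representing unions; injectivity makes this
  pair unique.\<close>

lemma contraction_order_iff:
  assumes "C \<in> dicycle_unions D" "C' \<in> dicycle_unions D"
  shows "(contract_arcs D C', contract_arcs D C) \<in> contraction_order D \<longleftrightarrow> C \<subseteq> C'"
proof -
  have "inj_on (contract_arcs D) (dicycle_unions D)"
    using inj_on_contract_arcs by (rule inj_on_subset) (auto dest: dicycle_unions_subset_arcs)
  then show ?thesis
    using assms unfolding contraction_order_def by (auto dest: inj_onD)
qed

text \<open>The converse order corresponds to inclusion of arc sets, whose laws carry over.\<close>

lemma partial_order_contraction_order: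
  "partial_order_on (dicycle_contractions D) ((contraction_order D)\<inverse>)"
  unfolding partial_order_on_def preorder_on_def
proof (intro conjI)
  show sub: "(contraction_order D)\<inverse> \<subseteq> dicycle_contractions D \<times> dicycle_contractions D"
    by (auto simp: contraction_order_def dicycle_contractions_def)
  show "refl_on (dicycle_contractions D) ((contraction_order D)\<inverse>)"
    by (auto simp: refl_on_def dicycle_contractions_def contraction_order_iff)
  show "trans ((contraction_order D)\<inverse>)"
  proof (rule transI)
    fix X Y Z
    assume XY: "(X, Y) \<in> (contraction_order D)\<inverse>" and YZ: "(Y, Z) \<in> (contraction_order D)\<inverse>"
    then have "X \<in> dicycle_contractions D" "Y \<in> dicycle_contractions D"
      "Z \<in> dicycle_contractions D"
      using sub by auto
    then show "(X, Z) \<in> (contraction_order D)\<inverse>"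
      using XY YZ by (auto simp: dicycle_contractions_def contraction_order_iff)
  qed
  show "antisym ((contraction_order D)\<inverse>)"
  proof (rule antisymI)
    fix X Y
    assume XY: "(X, Y) \<in> (contraction_order D)\<inverse>" and YX: "(Y, X) \<in> (contraction_order D)\<inverse>"
    then have "X \<in> dicycle_contractions D" "Y \<in> dicycle_contractions D"
      using sub by auto
    then show "X = Y"
      using XY YX by (auto simp: dicycle_contractions_def contraction_order_iff)
  qed
qed

text \<open>The empty union gives the least element of the converse order, so the interval up to
  \<open>contract_arcs D M\<close> consists of the contractions of unions inside \<open>M\<close>.
  The identity \<open>moebius_sum\<close> is transported along this bijection.\<close>

lemma sum_moebius_dicycle_unions:
  assumes "fin_digraph D" "M \<in> dicycle_unions D"
  shows "(\<Sum>C\<in>{C \<in> dicycle_unions D. C \<subseteq> M}.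
      moebius (dicycle_contractions D) ((contraction_order D)\<inverse>)
        (contract_arcs D {}) (contract_arcs D C))
    = (if M = {} then 1 else 0)"
proof -
  let ?c = "contract_arcs D" and ?U = "dicycle_unions D" and ?r = "(contraction_order D)\<inverse>"
  have inj: "inj_on ?c ?U"
    using inj_on_contract_arcs by (rule inj_on_subset) (auto dest: dicycle_unions_subset_arcs)
  have "{Y \<in> dicycle_contractions D. (?c {}, Y) \<in> ?r \<and> (Y, ?c M) \<in> ?r} = ?c ` {C \<in> ?U. C \<subseteq> M}"
    using assms(2) empty_in_dicycle_unions[of D]
    by (auto simp: dicycle_contractions_def contraction_order_iff)
  moreover have "(\<Sum>Y\<in>{Y \<in> dicycle_contractions D. (?c {}, Y) \<in> ?r \<and> (Y, ?c M) \<in> ?r}.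
      moebius (dicycle_contractions D) ?r (?c {}) Y) = (if ?c {} = ?c M then 1 else 0)"
    using assms empty_in_dicycle_unions[of D] finite_dicycle_unions[OF assms(1)]
    by (intro moebius_sum partial_order_contraction_order)
      (auto simp: dicycle_contractions_def contraction_order_iff)
  moreover have "?c {} = ?c M \<longleftrightarrow> M = {}"
    using inj_on_eq_iff[OF inj empty_in_dicycle_unions assms(2)] by auto
  moreover have "inj_on ?c {C \<in> ?U. C \<subseteq> M}"
    using inj by (rule inj_on_subset) auto
  ultimately show ?thesis
    by (simp add: sum.reindex)
qed

section \<open>Evaluating the polynomial and counting NL-coflows\<close>

lemma poly_psi_NL:
  assumes "fin_digraph D"
  shows "poly (psi_NL D) x = (\<Sum>C\<in>dicycle_unions D.
    moebius (dicycle_contractions D) ((contraction_order D)\<inverse>)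
      (contract_arcs D {}) (contract_arcs D C) * x ^ digraph_rank (contract_arcs D C))"
proof -
  have "inj_on (contract_arcs D) (dicycle_unions D)"
    using inj_on_contract_arcs by (rule inj_on_subset) (auto dest: dicycle_unions_subset_arcs)
  then show ?thesis
    unfolding psi_NL_def poly_sum poly_monom
    by (subst dicycle_contractions_def) (simp add: sum.reindex)
qed

text \<open>Enlarging a feedback arc set within the arcs gives another one, so the support itself
  may be tested: \<open>g\<close> must be nontrivial somewhere on every directed cycle. A directed
  cycle with trivial values is a nonempty member of the family, and every nonempty member contains a
  directed cycle.\<close>

lemma NL_coflow_iff:
  "NL_coflow D G g \<longleftrightarrow>
    coflow D G g \<and> \<Union>{C \<in> dicycle_unions D. \<forall>a\<in>C. g a = \<one>\<^bsub>G\<^esub>} = {}" (is "_ \<longleftrightarrow> _ \<and> ?M = {}")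
proof -
  have fas: "feedback_arc_set D S \<longleftrightarrow>
      S \<subseteq> arcs D \<and> (\<nexists>p. pre_digraph.cycle D p \<and> set p \<subseteq> arcs D - S)" for S
    by (simp add: feedback_arc_set_def cycle_restrict_arcs)
  have "(\<exists>S \<subseteq> coflow_support D G g. feedback_arc_set D S)
      \<longleftrightarrow> (\<nexists>p. pre_digraph.cycle D p \<and> (\<forall>a\<in>set p. g a = \<one>\<^bsub>G\<^esub>))" (is "?L \<longleftrightarrow> ?R")
  proof
    assume ?L
    then show ?R
      using cycle_arcs[of D] by (fastforce simp: fas coflow_support_def)
  next
    assume ?R
    then have "feedback_arc_set D (coflow_support D G g)"
      by (fastforce simp: fas coflow_support_def)
    then show ?L by auto
  qed
  also have "\<dots> \<longleftrightarrow> ?M = {}"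
  proof
    assume no_cycle: ?R
    have "C = {}" if C: "C \<in> dicycle_unions D" "\<forall>a\<in>C. g a = \<one>\<^bsub>G\<^esub>" for C
    proof -
      obtain P where P: "C = \<Union>(set ` P)" "\<forall>p\<in>P. pre_digraph.cycle D p"
        using C(1) by (auto simp: dicycle_unions_def)
      have "P = {}"
        using P C(2) no_cycle by blast
      then show ?thesis
        using P(1) by simp
    qed
    then show "?M = {}" by auto
  next
    assume M: "?M = {}"
    show ?R
    proof
      assume "\<exists>p. pre_digraph.cycle D p \<and> (\<forall>a\<in>set p. g a = \<one>\<^bsub>G\<^esub>)"
      then obtain p where p: "pre_digraph.cycle D p" "\<forall>a\<in>set p. g a = \<one>\<^bsub>G\<^esub>"
        by auto
      then have "set p \<subseteq> ?M"
        using cycle_in_dicycle_unions[OF p(1)] by auto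
      then show False
        using M cycle_arcs[OF p(1)] by simp
    qed
  qed
  finally show ?thesis
    by (simp add: NL_coflow_def)
qed

lemma card_NL_coflows:
  assumes "fin_digraph D" "comm_group G" "finite (carrier G)"
  shows "int (card {g. NL_coflow D G g}) = poly (psi_NL D) (int (Coset.order G))"
proof -
  interpret D: fin_digraph D by fact
  interpret G: comm_group G by fact
  let ?U = "dicycle_unions D"
  let ?F = "{g. coflow D G g}"
  let ?mu = "\<lambda>C. moebius (dicycle_contractions D) ((contraction_order D)\<inverse>)
    (contract_arcs D {}) (contract_arcs D C)"
  let ?M = "\<lambda>g. \<Union>{C \<in> ?U. \<forall>a\<in>C. g a = \<one>\<^bsub>G\<^esub>}"
  have finU: "finite ?U"
    using assms(1) by (rule finite_dicycle_unions)
  have finF: "finite ?F"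
    by (rule finite_subset[of _ "arcs D \<rightarrow>\<^sub>E carrier G"])
      (auto simp: coflow_def assms(3) intro!: finite_PiE)
  have M: "?M g \<in> ?U" for g
    using finU by (intro Union_in_dicycle_unions) auto
  \<comment> \<open>Being trivial on each set of the union, \<open>g\<close> is trivial on all of
    \<open>?M g\<close>.\<close>
  have below_M: "{C \<in> ?U. C \<subseteq> ?M g} = {C \<in> ?U. \<forall>a\<in>C. g a = \<one>\<^bsub>G\<^esub>}" for g
    by blast
  have "int (card {g. NL_coflow D G g}) = int (card {g \<in> ?F. ?M g = {}})"
    by (simp only: NL_coflow_iff mem_Collect_eq)
  also have "\<dots> = (\<Sum>g\<in>?F. if ?M g = {} then 1 else 0)"
    using finF by (simp add: sum.If_cases Int_def)
  \<comment> \<open>The indicator of an empty \<open>?M g\<close> is expanded as the Moebius sum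
    over the interval up to \<open>?M g\<close>.\<close>
  also have "\<dots> = (\<Sum>g\<in>?F. \<Sum>C\<in>{C \<in> ?U. \<forall>a\<in>C. g a = \<one>\<^bsub>G\<^esub>}. ?mu C)"
    by (simp only: sum_moebius_dicycle_unions[OF assms(1) M, unfolded below_M])
  \<comment> \<open>After the exchange the inner sum runs over the coflows trivial on a fixed
    \<open>C\<close>, whose number is a known power of the group order.\<close>
  also have "\<dots> = (\<Sum>C\<in>?U. \<Sum>g\<in>{g \<in> ?F. \<forall>a\<in>C. g a = \<one>\<^bsub>G\<^esub>}. ?mu C)"
    by (rule sum.swap_restrict[OF finF finU])
  also have "\<dots> = (\<Sum>C\<in>?U. ?mu C * int (card {g. coflow D G g \<and> (\<forall>a\<in>C. g a = \<one>\<^bsub>G\<^esub>)}))"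
    by (simp add: mult.commute)
  also have "\<dots> = (\<Sum>C\<in>?U. ?mu C * int (Coset.order G) ^ digraph_rank (contract_arcs D C))"
    using G.card_coflows_trivial_on[OF assms(1,3) dicycle_unions_subset_arcs]
    by (intro sum.cong) simp_all
  also have "\<dots> = poly (psi_NL D) (int (Coset.order G))"
    by (simp add: poly_psi_NL[OF assms(1)])
  finally show ?thesis .
qed

text \<open>Both counts are the value of one polynomial at \<open>k\<close>, so their equality
  follows from the formula. Separate type variables admit groups over different types.\<close>

theorem theorem3p2:
  fixes D :: "('a, 'b) pre_digraph"
    and G :: "('g, 'm) monoid_scheme"
    and H :: "('h, 'n) monoid_scheme"
    and k :: nat
  assumes "fin_digraph D"
    and "comm_group G" and "finite (carrier G)" and "Coset.order G = k"
    and "comm_group H" and "finite (carrier H)" and "Coset.order H = k"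
  shows "card {g. NL_coflow D G g} = card {g. NL_coflow D H g} \<and>
    int (card {g. NL_coflow D G g}) = poly (psi_NL D) (int k)"
  using card_NL_coflows[OF assms(1-3)] card_NL_coflows[OF assms(1,5,6)] assms(4,7) by simp

end
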